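(* For $n \geq 3$ and sufficiently large $d$, $$\overline{cr}_d\left(K_{d\times n}^d\right) = \Omega\left(2^{d}\right)\left(\frac{n}{2}\right)^d\left(\frac{n-1}{2}\right)^d.$$ That is, there exist an absolute constant $c>0$ and an integer $d_0$ such that for all integers $d \geq d_0$ and $n \geq 3$, $\overline{cr}_d\left(K_{d\times n}^d\right) \geq c\,2^{d}\,(n/2)^d\,((n-1)/2)^d$.
   Context: A hypergraph $H=(V,E)$ consists of a vertex set $V$ and a set $E$ of distinct subsets of $V$ called hyperedges; it is $d$-uniform if each hyperedge contains exactly $d$ vertices. $K_{d\times n}^d$ denotes the complete balanced $d$-partite $d$-uniform hypergraph with $n$ vertices in each part: its vertex set is the union of $d$ pairwise disjoint sets $X_1,\ldots,X_d$ with $|X_i|=n$ for each $i$, and its hyperedges are all the $n^d$ sets of $d$ vertices containing exactly one vertex from each $X_i$. A $d$-dimensional rectilinear drawing of a $d$-uniform hypergraph $H=(V,E)$ is an embedding of it in $\mathbb{R}^d$ in which the vertices are represented as (distinct) points in general position (i.e., no $d+1$ vertices lie on a common hyperplane) and each hyperedge is drawn as the $(d-1)$-simplex that is the convex hull of its $d$ vertices. In such a drawing, two hyperedges are crossing if they are vertex disjoint and contain a common point in their relative interiors. The $d$-dimensional rectilinear crossing number $\overline{cr}_d(H)$ is the minimum number of (unordered) crossing pairs of hyperedges among all $d$-dimensional rectilinear drawings of $H$. *)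

theory Defs
  imports "HOL-Analysis.Analysis" "HOL-Analysis.Finite_Function_Topology"
begin

(* The dimension d is quantified inside the main statement, so R^d cannot be a type depending
   on d. It is the subspace of vectors with support in {0,...,d-1} of the real normed space
   of finitely supported real sequences. Convex hulls, affine dependence and relative interiors
   (taken with respect to the affine hull) are therefore the library notions and agree with
   those in R^d. *)

type_synonym point = "nat \<Rightarrow>\<^sub>0 real"

definition Rspace :: "nat \<Rightarrow> point set" where
  "Rspace d = {x. Poly_Mapping.keys x \<subseteq> {..<d}}"

definition is_hyperplane :: "nat \<Rightarrow> point set \<Rightarrow> bool" where
  "is_hyperplane d h \<longleftrightarrow>
    (\<exists>(a :: nat \<Rightarrow> real) b. (\<exists>i<d. a i \<noteq> 0) \<and>
      h = {x \<in> Rspace d. (\<Sum>i<d. a i * Poly_Mapping.lookup x i) = b})"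

definition general_position :: "nat \<Rightarrow> point set \<Rightarrow> bool" where
  "general_position d P \<longleftrightarrow>
    (\<forall>S\<subseteq>P. card S = d + 1 \<longrightarrow> \<not> (\<exists>h. is_hyperplane d h \<and> S \<subseteq> h))"

(* The last conjunct says that the hull of the d vertices of a hyperedge really is a
   (d-1)-simplex. It follows from general position when V has at least d + 1 vertices. *)
definition rectilinear_drawing ::
    "nat \<Rightarrow> 'v set \<Rightarrow> 'v set set \<Rightarrow> ('v \<Rightarrow> point) \<Rightarrow> bool" where
  "rectilinear_drawing d V E p \<longleftrightarrow>
    p ` V \<subseteq> Rspace d \<and> inj_on p V \<and> general_position d (p ` V) \<and>
    (\<forall>e\<in>E. \<not> affine_dependent (p ` e))"

definition crossing :: "('v \<Rightarrow> point) \<Rightarrow> 'v set \<Rightarrow> 'v set \<Rightarrow> bool" where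
  "crossing p e f \<longleftrightarrow> e \<inter> f = {} \<and>
    rel_interior (convex hull (p ` e)) \<inter> rel_interior (convex hull (p ` f)) \<noteq> {}"

definition crossing_pairs :: "'v set set \<Rightarrow> ('v \<Rightarrow> point) \<Rightarrow> 'v set set set" where
  "crossing_pairs E p = {{e, f} | e f. e \<in> E \<and> f \<in> E \<and> e \<noteq> f \<and> crossing p e f}"

definition rectilinear_crossing_number :: "nat \<Rightarrow> 'v set \<Rightarrow> 'v set set \<Rightarrow> nat" where
  "rectilinear_crossing_number d V E =
    (LEAST k. \<exists>p. rectilinear_drawing d V E p \<and> k = card (crossing_pairs E p))"

definition part :: "nat \<Rightarrow> nat \<Rightarrow> (nat \<times> nat) set" where
  "part n i = {i} \<times> {..<n}"

definition balanced_vertices :: "nat \<Rightarrow> nat \<Rightarrow> (nat \<times> nat) set" where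
  "balanced_vertices d n = (\<Union>i<d. part n i)"

definition balanced_edges :: "nat \<Rightarrow> nat \<Rightarrow> (nat \<times> nat) set set" where
  "balanced_edges d n =
    {e. e \<subseteq> balanced_vertices d n \<and> card e = d \<and> (\<forall>i<d. card (e \<inter> part n i) = 1)}"

end

theory Submission
  imports Defs
begin

text \<open>
  A crossing is a sign pattern. If an affine relation among some vertices has exactly one positive
  and one negative coefficient in each part, then, after normalisation, the positive and the
  negative coefficients exhibit one point in the relative interiors of two vertex-disjoint
  hyperedges (\<open>crossing_of_signed_relation\<close>). Moreover, in general position a nonzero
  relation can be perturbed so that all its vanishing coefficients get prescribed signs
  (\<open>perturb_to_prescribed_signs\<close>). So it is enough to find a nonzero relation in which no
  part contains two positive or two negative coefficients.
  
  Two vertices from each part do not suffice for this: if the parts are the pairs of opposite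
  vertices of a slightly perturbed cross-polytope, the hyperedges are its facets, and no two of them
  cross. But a bounded excess does. Take three vertices in two of the parts and two vertices in
  each other part: $2d+2$ points, whose relations form a space of dimension at least $d+1$.
  Demanding that the two coefficients in each of the $d-2$ pairs sum to $0$ leaves dimension at
  least $3$. On a triple the pattern asks that the median of the three coefficients be $0$. The
  median is odd and continuous, so two medians could be killed on a $2$-sphere by the Borsuk-Ulam
  theorem. Here the intermediate value theorem does the job, because the zero set of the first
  median contains an explicit path from a relation to its negative, and the second median changes
  sign along that path (\<open>sign_split_two_triples\<close>).
  
  Hence every selection of three vertices in two fixed parts and of two in the others contains a
  crossing (\<open>crossing_in_selection\<close>). There are $\binom n3^2\binom n2^{d-2}$ selections, and
  a crossing pair, which uses two vertices of each part, lies in at most $(n-2)^2$ of them. Since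
  $3\binom n3=(n-2)\binom n2$, this gives at least $\frac19\binom n2^d$ crossing pairs
  (\<open>crossing_pairs_lower_bound\<close>). The theorem then holds with $c=1/9$ and $d_0=2$. The crossing
  number is a least element, so the bound also requires that some drawing exists: points on the
  moment curve provide one (\<open>rectilinear_drawing_exists\<close>).
\<close>

section \<open>Homogeneous linear systems\<close>

lemma homogeneous_system_nontrivial_solution:
  fixes M :: "'j \<Rightarrow> 'i \<Rightarrow> real"
  assumes "finite J" "finite I" "card J < card I"
  shows "\<exists>x. (\<exists>i\<in>I. x i \<noteq> 0) \<and> (\<forall>j\<in>J. (\<Sum>i\<in>I. M j i * x i) = 0)"
  using assms
proof (induction J arbitrary: I M rule: finite_induct)
  case empty
  then obtain i where "i \<in> I" by fastforce
  then show ?case by (intro exI[of _ "\<lambda>_. 1"]) auto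
next
  case (insert j J)
  show ?case
  proof (cases "\<forall>i\<in>I. M j i = 0")
    case True
    have "card J < card I" using insert by simp
    from insert.IH[OF insert.prems(1) this, of M] obtain x where
      "\<exists>i\<in>I. x i \<noteq> 0" "\<forall>j\<in>J. (\<Sum>i\<in>I. M j i * x i) = 0" by auto
    then show ?thesis using True by (intro exI[of _ x]) auto
  next
    case False
    then obtain k where k: "k \<in> I" "M j k \<noteq> 0" by auto
    define N where "N = (\<lambda>l i. M l i - M l k * M j i / M j k)"
    have "card J < card (I - {k})" using insert k by simp
    from insert.IH[OF _ this, of N] insert.prems obtain x where
      x: "\<exists>i\<in>I - {k}. x i \<noteq> 0" "\<forall>l\<in>J. (\<Sum>i\<in>I - {k}. N l i * x i) = 0" by auto
    define s where "s = (\<Sum>i\<in>I - {k}. M j i * x i)"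
    define y where "y = x(k := - s / M j k)"
    have split: "(\<Sum>i\<in>I. M l i * y i) = M l k * y k + (\<Sum>i\<in>I - {k}. M l i * x i)" for l
    proof -
      have "(\<Sum>i\<in>I - {k}. M l i * y i) = (\<Sum>i\<in>I - {k}. M l i * x i)"
        by (rule sum.cong) (auto simp: y_def)
      then show ?thesis using sum.remove[OF insert.prems(1) k(1), of "\<lambda>i. M l i * y i"] by simp
    qed
    have "(\<Sum>i\<in>I. M l i * y i) = 0" if "l \<in> J" for l
    proof -
      have "0 = (\<Sum>i\<in>I - {k}. M l i * x i - M l k / M j k * (M j i * x i))"
      proof -
        have "N l i * x i = M l i * x i - M l k / M j k * (M j i * x i)" for i
          using k(2) by (simp add: N_def field_simps)
        then have "(\<Sum>i\<in>I - {k}. N l i * x i) = (\<Sum>i\<in>I - {k}. M l i * x i - M l k / M j k * (M j i * x i))"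
          by (intro sum.cong refl)
        then show ?thesis using x(2) that by metis
      qed
      also have "\<dots> = (\<Sum>i\<in>I - {k}. M l i * x i) - M l k / M j k * s"
        by (simp add: sum_subtractf sum_distrib_left s_def)
      finally show ?thesis unfolding split by (simp add: y_def)
    qed
    moreover have "(\<Sum>i\<in>I. M j i * y i) = 0"
      unfolding split using k(2) by (simp add: y_def s_def)
    moreover have "\<exists>i\<in>I. y i \<noteq> 0" using x(1) by (auto simp: y_def)
    ultimately show ?thesis by blast
  qed
qed

section \<open>Linear relations and their signs\<close>
definition linear_relation :: "nat \<Rightarrow> ('v \<Rightarrow> nat \<Rightarrow> real) \<Rightarrow> 'v set \<Rightarrow> ('v \<Rightarrow> real) \<Rightarrow> bool" where
  "linear_relation D h S x \<longleftrightarrow> (\<forall>m<D. (\<Sum>v\<in>S. x v * h v m) = 0)"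

text \<open>
  Points of $\mathbb R^d$ in general position correspond, in homogeneous coordinates, to vectors
  of $\mathbb R^D$ with $D=d+1$ any $D$ of which are linearly independent: the vectors realise a
  uniform oriented matroid.
\<close>
definition uniform :: "nat \<Rightarrow> ('v \<Rightarrow> nat \<Rightarrow> real) \<Rightarrow> 'v set \<Rightarrow> bool" where
  "uniform D h V \<longleftrightarrow>
    (\<forall>S\<subseteq>V. card S \<le> D \<longrightarrow> (\<forall>x. linear_relation D h S x \<longrightarrow> (\<forall>v\<in>S. x v = 0)))"

lemma linear_relation_combine:
  assumes "linear_relation D h S x" "linear_relation D h S y"
  shows "linear_relation D h S (\<lambda>v. s * x v + t * y v)"
proof -
  have "(\<Sum>v\<in>S. (s * x v + t * y v) * h v m)
      = s * (\<Sum>v\<in>S. x v * h v m) + t * (\<Sum>v\<in>S. y v * h v m)" for m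
    by (simp add: sum.distrib sum_distrib_left algebra_simps)
  then show ?thesis using assms by (simp add: linear_relation_def)
qed

lemma linear_relation_sum:
  assumes "finite K" "\<And>k. k \<in> K \<Longrightarrow> linear_relation D h S (x k)"
  shows "linear_relation D h S (\<lambda>v. \<Sum>k\<in>K. c k * x k v)"
  using assms
proof (induction K rule: finite_induct)
  case empty
  then show ?case by (simp add: linear_relation_def)
next
  case (insert k K)
  then have "linear_relation D h S (\<lambda>v. c k * x k v + 1 * (\<Sum>k\<in>K. c k * x k v))"
    by (intro linear_relation_combine) auto
  then show ?case using insert.hyps by simp
qed

lemma linear_relation_restrict:
  assumes "finite V" "S \<subseteq> V" "\<And>v. v \<in> V - S \<Longrightarrow> x v = 0"
  shows "linear_relation D h V x \<longleftrightarrow> linear_relation D h S x"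
proof -
  have "(\<Sum>v\<in>V. x v * h v m) = (\<Sum>v\<in>S. x v * h v m)" for m
    by (rule sum.mono_neutral_right) (use assms in auto)
  then show ?thesis by (simp add: linear_relation_def)
qed

text \<open>
  Uniformity forces the support $T$ of a nonzero relation to have more than $D$ elements. For
  a vertex $z$ outside $T$ there is a relation supported on $z$ and $D$ elements of $T$, and
  again by uniformity its coefficient at $z$ is nonzero. So the coefficients outside $T$ can be
  chosen freely, by a change that on $T$ is too small to affect signs.
\<close>
lemma perturb_to_prescribed_signs:
  fixes x \<sigma> :: "'v \<Rightarrow> real"
  assumes fin: "finite V" and uni: "uniform D h V"
    and rel: "linear_relation D h V x" and nz: "\<exists>v\<in>V. x v \<noteq> 0"
    and sgn: "\<And>v. v \<in> V \<Longrightarrow> \<sigma> v \<noteq> 0 \<and> 0 \<le> x v * \<sigma> v"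
  shows "\<exists>y. linear_relation D h V y \<and> (\<forall>v\<in>V. 0 < y v * \<sigma> v)"
proof -
  define T where "T = {v \<in> V. x v \<noteq> 0}"
  have T: "T \<subseteq> V" "finite T" using fin by (auto simp: T_def)
  have "linear_relation D h T x"
    using rel linear_relation_restrict[OF fin T(1)] by (auto simp: T_def)
  then have "\<forall>v\<in>T. x v = 0" if "card T \<le> D"
    using uni T(1) that unfolding uniform_def by blast
  moreover have "\<not> (\<forall>v\<in>T. x v = 0)" using nz by (auto simp: T_def)
  ultimately have "\<not> card T \<le> D" by blast
  then obtain B where B: "B \<subseteq> T" "card B = D" "finite B"
    using obtain_subset_with_card_n[of D T] by (metis nat_le_linear)
  have "\<exists>\<mu>. linear_relation D h V \<mu> \<and> \<mu> z = 1 \<and> (\<forall>v\<in>V - T - {z}. \<mu> v = 0)"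
    if z: "z \<in> V - T" for z
  proof -
    have zB: "z \<notin> B" "insert z B \<subseteq> V" using z B T by auto
    have "card {..<D} < card (insert z B)" using B zB by simp
    from homogeneous_system_nontrivial_solution[OF _ _ this, of "\<lambda>m v. h v m"] B(3)
    obtain \<nu> where \<nu>: "\<exists>v\<in>insert z B. \<nu> v \<noteq> 0" "\<forall>m<D. (\<Sum>v\<in>insert z B. h v m * \<nu> v) = 0"
      by auto
    then have rB: "linear_relation D h (insert z B) \<nu>"
      by (simp add: linear_relation_def mult.commute)
    have nuz: "\<nu> z \<noteq> 0"
    proof
      assume "\<nu> z = 0"
      then have "linear_relation D h B \<nu>"
        using rB linear_relation_restrict[of "insert z B" B \<nu> D h] B(3) by auto
      then have "\<forall>v\<in>B. \<nu> v = 0" using uni B T unfolding uniform_def by blast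
      then show False using \<nu>(1) \<open>\<nu> z = 0\<close> by auto
    qed
    define \<mu> where "\<mu> = (\<lambda>v. if v \<in> insert z B then \<nu> v / \<nu> z else 0)"
    have "linear_relation D h (insert z B) (\<lambda>v. (1 / \<nu> z) * \<nu> v + 0 * \<nu> v)"
      by (rule linear_relation_combine[OF rB rB])
    then have "linear_relation D h (insert z B) \<mu>"
      unfolding linear_relation_def by (simp add: \<mu>_def)
    then have "linear_relation D h V \<mu>"
      using linear_relation_restrict[OF fin zB(2), of \<mu> D h] by (auto simp: \<mu>_def)
    moreover have "\<mu> z = 1" using nuz by (simp add: \<mu>_def)
    ultimately show ?thesis using B by (intro exI[of _ \<mu>]) (auto simp: \<mu>_def)
  qed
  then have "\<exists>\<mu>. \<forall>z\<in>V - T. linear_relation D h V (\<mu> z) \<and> \<mu> z z = 1 \<and> (\<forall>v\<in>V - T - {z}. \<mu> z v = 0)"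
    by (intro bchoice ballI)
  then obtain \<mu> where \<mu>: "\<And>z. z \<in> V - T \<Longrightarrow> linear_relation D h V (\<mu> z)"
    "\<And>z. z \<in> V - T \<Longrightarrow> \<mu> z z = 1" "\<And>z v. z \<in> V - T \<Longrightarrow> v \<in> V - T - {z} \<Longrightarrow> \<mu> z v = 0"
    by blast
  \<comment> \<open>The relation \<open>c\<close> equals \<open>\<sigma>\<close> outside \<open>T\<close>; a small positive multiple of it is added to \<open>x\<close>.\<close>
  define c where "c = (\<lambda>v. \<Sum>z\<in>V - T. \<sigma> z * \<mu> z v)"
  have c_rel: "linear_relation D h V c"
    unfolding c_def by (rule linear_relation_sum) (use fin \<mu>(1) in auto)
  have c_Z: "c z = \<sigma> z" if "z \<in> V - T" for z
  proof -
    have "c z = \<sigma> z * \<mu> z z + (\<Sum>w\<in>V - T - {z}. \<sigma> w * \<mu> w z)"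
      unfolding c_def by (rule sum.remove) (use fin that in auto)
    also have "(\<Sum>w\<in>V - T - {z}. \<sigma> w * \<mu> w z) = 0"
      by (rule sum.neutral) (use \<mu>(3) that in auto)
    finally show ?thesis using \<mu>(2)[OF that] by simp
  qed
  have "eventually (\<lambda>\<epsilon>. 0 < (x v + \<epsilon> * c v) * \<sigma> v) (at_right 0)" if "v \<in> T" for v
  proof -
    have "0 < x v * \<sigma> v" using sgn[of v] that T by (force simp: T_def less_le)
    moreover have "((\<lambda>\<epsilon>. (x v + \<epsilon> * c v) * \<sigma> v) \<longlongrightarrow> x v * \<sigma> v) (at_right 0)"
      by (auto intro!: tendsto_eq_intros)
    ultimately show ?thesis by (rule order_tendstoD(1)[rotated])
  qed
  then have "eventually (\<lambda>\<epsilon>. \<forall>v\<in>T. 0 < (x v + \<epsilon> * c v) * \<sigma> v) (at_right 0)"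
    by (intro eventually_ball_finite) (use T in auto)
  moreover have "eventually (\<lambda>\<epsilon>::real. 0 < \<epsilon>) (at_right 0)"
    by (simp add: eventually_at_right_less)
  ultimately have "eventually (\<lambda>\<epsilon>. 0 < \<epsilon> \<and> (\<forall>v\<in>T. 0 < (x v + \<epsilon> * c v) * \<sigma> v)) (at_right 0)"
    by eventually_elim auto
  then obtain \<epsilon> where \<epsilon>: "0 < \<epsilon>" "\<forall>v\<in>T. 0 < (x v + \<epsilon> * c v) * \<sigma> v"
    using eventually_happens[of _ "at_right (0::real)"] by auto
  have "0 < (x v + \<epsilon> * c v) * \<sigma> v" if "v \<in> V - T" for v
    using c_Z[OF that] \<epsilon>(1) sgn[of v] that by (auto simp: T_def zero_less_mult_iff mult.assoc)
  moreover have "linear_relation D h V (\<lambda>v. 1 * x v + \<epsilon> * c v)"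
    by (rule linear_relation_combine[OF rel c_rel])
  ultimately show ?thesis using \<epsilon>(2) by (intro exI[of _ "\<lambda>v. x v + \<epsilon> * c v"]) auto
qed

text \<open>
  At most one value is positive and at most one is negative. Coefficients that vanish are allowed,
  since a perturbation can give them any sign.
\<close>
definition sign_split :: "('v \<Rightarrow> real) \<Rightarrow> 'v set \<Rightarrow> bool" where
  "sign_split x A \<longleftrightarrow> (\<forall>u\<in>A. \<forall>v\<in>A. u \<noteq> v \<longrightarrow> x u * x v \<le> 0)"

lemma sign_split_poles:
  assumes "sign_split x A" "2 \<le> card A"
  obtains p q where "p \<in> A" "q \<in> A" "p \<noteq> q" "0 \<le> x p" "x q \<le> 0"
    "\<And>v. v \<in> A - {p, q} \<Longrightarrow> x v = 0"
proof -
  have fin: "finite A" using assms(2) by (metis card.infinite not_numeral_le_zero)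
  have other: "\<exists>w\<in>A. w \<noteq> v" for v
  proof (rule ccontr)
    assume "\<not> (\<exists>w\<in>A. w \<noteq> v)"
    then have "A \<subseteq> {v}" by auto
    then show False using card_mono[of "{v}" A] assms(2) by simp
  qed
  have neq: "\<not> (0 < x u \<and> 0 < x v)" "\<not> (x u < 0 \<and> x v < 0)" if "u \<in> A" "v \<in> A" "u \<noteq> v" for u v
    using assms(1) that unfolding sign_split_def
    by (meson mult_pos_pos mult_neg_neg not_le)+
  consider (both) p q where "p \<in> A" "q \<in> A" "0 < x p" "x q < 0"
    | (pos) p where "p \<in> A" "0 < x p" "\<forall>v\<in>A. 0 \<le> x v"
    | (neg) q where "q \<in> A" "x q < 0" "\<forall>v\<in>A. x v \<le> 0"
    | (zero) "\<forall>v\<in>A. x v = 0"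
    by (meson linorder_le_less_linear order_antisym)
  then show thesis
  proof cases
    case both
    show thesis
    proof (rule that[of p q])
      fix v assume v: "v \<in> A - {p, q}"
      show "x v = 0" using neq(1)[of v p] neq(2)[of v q] v both by force
    qed (use both in auto)
  next
    case pos
    obtain q where "q \<in> A" "q \<noteq> p" using other by blast
    moreover have z: "x v = 0" if "v \<in> A" "v \<noteq> p" for v
      using neq(1)[of v p] that pos by force
    ultimately show thesis by (intro that[of p q]) (use pos in auto)
  next
    case neg
    obtain p where "p \<in> A" "p \<noteq> q" using other by blast
    moreover have z: "x v = 0" if "v \<in> A" "v \<noteq> q" for v
      using neq(2)[of v q] that neg by force
    ultimately show thesis by (intro that[of p q]) (use neg in auto)
  next
    case zero
    have "A \<noteq> {}" using assms(2) by auto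
    then obtain p where "p \<in> A" by auto
    moreover obtain q where "q \<in> A" "q \<noteq> p" using other by blast
    ultimately show thesis by (intro that[of p q]) (use zero in auto)
  qed
qed

definition median :: "real \<Rightarrow> real \<Rightarrow> real \<Rightarrow> real" where
  "median a b c = max (min a b) (min (max a b) c)"

lemma median_minus: "median (- a) (- b) (- c) = - median a b c"
  by (auto simp: median_def max_def min_def)

text \<open>
  The median turns the sign pattern into the zero set of an odd continuous function.
\<close>
lemma median_zero_sign_split:
  assumes "median (x a) (x b) (x c) = 0"
  shows "sign_split x {a, b, c}"
  using assms
  by (auto simp: sign_split_def median_def mult_le_0_iff max_def min_def split: if_splits)

lemma median_zero_on_segment:
  fixes x y :: "'v \<Rightarrow> real"
  assumes "median (x a) (x b) (x c) * median (y a) (y b) (y c) \<le> 0"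
  shows "\<exists>t. 0 \<le> t \<and> t \<le> 1 \<and> median ((1 - t) * x a + t * y a) ((1 - t) * x b + t * y b)
    ((1 - t) * x c + t * y c) = 0"
proof -
  define f where "f = (\<lambda>t. median ((1 - t) * x a + t * y a) ((1 - t) * x b + t * y b)
    ((1 - t) * x c + t * y c))"
  have cont: "continuous_on {0..1} f"
    unfolding f_def median_def by (intro continuous_intros)
  have "f 0 \<le> 0 \<and> 0 \<le> f 1 \<or> 0 \<le> f 0 \<and> f 1 \<le> 0"
    using assms by (auto simp: f_def mult_le_0_iff)
  then have "\<exists>t. 0 \<le> t \<and> t \<le> 1 \<and> f t = 0"
    using IVT'[of f 0 0 1] IVT2'[of f 1 0 0] cont by auto
  then show ?thesis by (simp add: f_def)
qed

text \<open>
  A path $x_0,x_1,x_2,-x_0$ inside \<open>P\<close> carries a zero of the median, because the median has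
  opposite values at its two ends. The three segments are kept explicit since \<open>P\<close> is in general
  not convex.
\<close>
lemma median_zero_on_half_turn:
  fixes x0 x1 x2 :: "'v \<Rightarrow> real"
  assumes P0: "\<And>t. 0 \<le> t \<Longrightarrow> t \<le> 1 \<Longrightarrow> P (\<lambda>v. (1 - t) * x0 v + t * x1 v)"
    and P1: "\<And>t. 0 \<le> t \<Longrightarrow> t \<le> 1 \<Longrightarrow> P (\<lambda>v. (1 - t) * x1 v + t * x2 v)"
    and P2: "\<And>t. 0 \<le> t \<Longrightarrow> t \<le> 1 \<Longrightarrow> P (\<lambda>v. (1 - t) * x2 v + t * (- x0 v))"
  shows "\<exists>x. P x \<and> median (x a) (x b) (x c) = 0"
proof -
  define m where "m x = median (x a) (x b) (x c)" for x :: "'v \<Rightarrow> real"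
  have "m (\<lambda>v. - x0 v) = - m x0" by (simp add: m_def median_minus)
  then have "m x2 * m (\<lambda>v. - x0 v) = - (m x2 * m x0)" by simp
  then have "m x0 * m x1 \<le> 0 \<or> m x1 * m x2 \<le> 0 \<or> m x2 * m (\<lambda>v. - x0 v) \<le> 0"
    by (auto simp: mult_le_0_iff zero_le_mult_iff)
  then show ?thesis
  proof (elim disjE)
    assume "m x0 * m x1 \<le> 0"
    then obtain t where t: "0 \<le> t" "t \<le> 1"
      "median ((1 - t) * x0 a + t * x1 a) ((1 - t) * x0 b + t * x1 b) ((1 - t) * x0 c + t * x1 c) = 0"
      using median_zero_on_segment[of x0 a b c "x1"] by (auto simp: m_def)
    then show ?thesis using P0[OF t(1,2)] by (intro exI conjI)
  next
    assume "m x1 * m x2 \<le> 0"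
    then obtain t where t: "0 \<le> t" "t \<le> 1"
      "median ((1 - t) * x1 a + t * x2 a) ((1 - t) * x1 b + t * x2 b) ((1 - t) * x1 c + t * x2 c) = 0"
      using median_zero_on_segment[of x1 a b c "x2"] by (auto simp: m_def)
    then show ?thesis using P1[OF t(1,2)] by (intro exI conjI)
  next
    assume "m x2 * m (\<lambda>v. - x0 v) \<le> 0"
    then obtain t where t: "0 \<le> t" "t \<le> 1"
      "median ((1 - t) * x2 a + t * (- x0 a)) ((1 - t) * x2 b + t * (- x0 b)) ((1 - t) * x2 c + t * (- x0 c)) = 0"
      using median_zero_on_segment[of x2 a b c "\<lambda>v. - x0 v"] by (auto simp: m_def)
    then show ?thesis using P2[OF t(1,2)] by (intro exI conjI)
  qed
qed

text \<open>
  The hypothesis \<open>dim\<close> says that the restriction of \<open>L\<close> to \<open>V\<close> has dimension at least $3$.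
  If no nonzero vector of \<open>L\<close> vanishes on the whole first triple, there are vectors $e_i$ in \<open>L\<close>
  with coefficient $1$ at $a_i$ and $0$ at the two other elements. On the edges of the path
  $e_1,-e_2,e_3,-e_1$ one coefficient of the triple is $0$ and the two others never have equal signs.
  If some nonzero $\nu$ does vanish on the triple, then adding multiples of $\nu$ to a vector does
  not change its pattern there, so the path $\nu,w,-\nu$ works for each $w$ that has the pattern and
  is independent of $\nu$.
\<close>
lemma sign_split_two_triples:
  fixes L :: "('v \<Rightarrow> real) set"
  assumes lin: "\<And>x y s t. x \<in> L \<Longrightarrow> y \<in> L \<Longrightarrow> (\<lambda>v. s * x v + t * y v) \<in> L"
    and dim: "\<And>u v. u \<in> V \<Longrightarrow> v \<in> V \<Longrightarrow> \<exists>x\<in>L. (\<exists>w\<in>V. x w \<noteq> 0) \<and> x u = 0 \<and> x v = 0"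
    and a: "a1 \<in> V" "a2 \<in> V" "a3 \<in> V" "a1 \<noteq> a2" "a1 \<noteq> a3" "a2 \<noteq> a3"
  shows "\<exists>x\<in>L. (\<exists>w\<in>V. x w \<noteq> 0) \<and> sign_split x {a1, a2, a3} \<and> sign_split x {b1, b2, b3}"
proof -
  define P where "P x \<longleftrightarrow> x \<in> L \<and> (\<exists>w\<in>V. x w \<noteq> 0) \<and> sign_split x {a1, a2, a3}" for x
  have split_iff: "sign_split x {a1, a2, a3} \<longleftrightarrow>
      x a1 * x a2 \<le> 0 \<and> x a1 * x a3 \<le> 0 \<and> x a2 * x a3 \<le> 0" for x
    using a by (auto simp: sign_split_def mult.commute)
  have "\<exists>x. P x \<and> median (x b1) (x b2) (x b3) = 0"
  proof (cases "\<exists>\<nu>\<in>L. (\<exists>w\<in>V. \<nu> w \<noteq> 0) \<and> \<nu> a1 = 0 \<and> \<nu> a2 = 0 \<and> \<nu> a3 = 0")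
    case True
    then obtain \<nu> c where \<nu>: "\<nu> \<in> L" "c \<in> V" "\<nu> c \<noteq> 0" "\<nu> a1 = 0" "\<nu> a2 = 0" "\<nu> a3 = 0"
      by auto
    \<comment> \<open>Vanishing at \<open>c\<close>, where \<open>\<nu>\<close> does not vanish, makes a nonzero \<open>w\<close> independent of \<open>\<nu>\<close>.\<close>
    have "\<exists>w. P w \<and> w c = 0"
    proof -
      obtain w where w: "w \<in> L" "\<exists>v\<in>V. w v \<noteq> 0" "w a1 = 0" "w c = 0"
        using dim[OF a(1) \<nu>(2)] by auto
      obtain w' where w': "w' \<in> L" "\<exists>v\<in>V. w' v \<noteq> 0" "w' a2 = 0" "w' c = 0"
        using dim[OF a(2) \<nu>(2)] by auto
      show ?thesis
      proof (cases "w a2 * w a3 \<le> 0 \<or> w' a1 * w' a3 \<le> 0")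
        case True
        then show ?thesis using w w' by (auto simp: P_def split_iff)
      next
        case False
        \<comment> \<open>On the triple, \<open>w\<close> is \<open>(0, *, *)\<close> and \<open>w'\<close> is \<open>(*, 0, *)\<close>, each with its
          two entries of equal sign. Eliminating the third entry leaves opposite signs in the first two.\<close>
        define u where "u = (\<lambda>v. w' a3 * w v + (- w a3) * w' v)"
        have "0 < (w a2 * w a3) * (w' a1 * w' a3)"
          by (rule mult_pos_pos) (use False in auto)
        then have "u a1 * u a2 < 0" "u a3 = 0"
          using w w' by (auto simp: u_def algebra_simps)
        moreover have "u \<in> L" unfolding u_def by (rule lin) (use w w' in auto)
        ultimately have "P u" unfolding P_def split_iff using a by force
        moreover have "u c = 0" using w w' by (simp add: u_def)
        ultimately show ?thesis by blast
      qed
    qed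
    then obtain w where w: "P w" "w c = 0" by blast
    have comb: "P (\<lambda>v. s * \<nu> v + t * w v)" if "s \<noteq> 0 \<or> t \<noteq> 0" for s t
      unfolding P_def
    proof (intro conjI)
      show "(\<lambda>v. s * \<nu> v + t * w v) \<in> L" using lin \<nu>(1) w(1) by (simp add: P_def)
      show "\<exists>v\<in>V. s * \<nu> v + t * w v \<noteq> 0"
      proof (cases "s = 0")
        case True
        then show ?thesis using that w(1) by (auto simp: P_def)
      next
        case False
        then show ?thesis using \<nu> w(2) by (intro bexI[of _ c]) auto
      qed
      have "t * w u * (t * w v) \<le> 0" if "w u * w v \<le> 0" for u v
      proof -
        have "t * w u * (t * w v) = (t * t) * (w u * w v)" by (simp only: mult_ac)
        moreover have "(t * t) * (w u * w v) \<le> 0" by (rule mult_nonneg_nonpos) (use that in auto)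
        ultimately show ?thesis by (rule ord_eq_le_trans)
      qed
      then show "sign_split (\<lambda>v. s * \<nu> v + t * w v) {a1, a2, a3}"
        using w(1) \<nu> by (simp add: P_def split_iff)
    qed
    show ?thesis
    proof (rule median_zero_on_half_turn[of P \<nu> w w])
      fix t :: real assume t: "0 \<le> t" "t \<le> 1"
      show "P (\<lambda>v. (1 - t) * \<nu> v + t * w v)" using comb[of "1 - t" t] by auto
      show "P (\<lambda>v. (1 - t) * w v + t * w v)" using comb[of 0 1] by (simp add: algebra_simps)
      show "P (\<lambda>v. (1 - t) * w v + t * (- \<nu> v))" using comb[of "- t" "1 - t"]
        by (auto simp: algebra_simps)
    qed
  next
    case False
    have "\<exists>x\<in>L. x u = 0 \<and> x v = 0 \<and> x w = 1"
      if uvw: "{u, v, w} = {a1, a2, a3}" for u v w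
    proof -
      have "u \<in> V" "v \<in> V" using uvw a by auto
      then obtain x where x: "x \<in> L" "\<exists>w\<in>V. x w \<noteq> 0" "x u = 0" "x v = 0" using dim by blast
      have "x w \<noteq> 0"
      proof
        assume "x w = 0"
        then have "\<forall>s\<in>{u, v, w}. x s = 0" using x by auto
        then show False using False x uvw by auto
      qed
      moreover have "(\<lambda>s. (1 / x w) * x s + 0 * x s) \<in> L" by (rule lin) (use x in auto)
      ultimately show ?thesis using x by (intro bexI[of _ "\<lambda>s. (1 / x w) * x s + 0 * x s"]) auto
    qed
    from this[of a2 a3 a1] this[of a1 a3 a2] this[of a1 a2 a3] obtain e1 e2 e3 where
      e1: "e1 \<in> L" "e1 a1 = 1" "e1 a2 = 0" "e1 a3 = 0" and
      e2: "e2 \<in> L" "e2 a1 = 0" "e2 a2 = 1" "e2 a3 = 0" and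
      e3: "e3 \<in> L" "e3 a1 = 0" "e3 a2 = 0" "e3 a3 = 1"
      by (auto simp: insert_commute)
    show ?thesis
    proof (rule median_zero_on_half_turn[of P e1 "\<lambda>v. - e2 v" e3])
      fix t :: real assume t: "0 \<le> t" "t \<le> 1"
      have tt: "t * (1 - t) \<ge> 0" "1 - t = 0 \<longrightarrow> t \<noteq> 0" using t by auto
      have "(\<lambda>v. (1 - t) * e1 v + (- t) * e2 v) \<in> L" by (rule lin) (use e1 e2 in auto)
      moreover have "\<exists>w\<in>V. (1 - t) * e1 w + (- t) * e2 w \<noteq> 0"
        using tt a e1 e2 by (cases "t = 1") force+
      ultimately show "P (\<lambda>v. (1 - t) * e1 v + t * (- e2 v))"
        using tt e1 e2 by (simp add: P_def split_iff mult.commute)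
      have "(\<lambda>v. (- (1 - t)) * e2 v + t * e3 v) \<in> L" by (rule lin) (use e3 e2 in auto)
      moreover have "\<exists>w\<in>V. (- (1 - t)) * e2 w + t * e3 w \<noteq> 0"
        using tt a e2 e3 by (cases "t = 1") force+
      ultimately show "P (\<lambda>v. (1 - t) * (- e2 v) + t * e3 v)"
        using tt e2 e3 by (simp add: P_def split_iff algebra_simps)
      have "(\<lambda>v. (1 - t) * e3 v + (- t) * e1 v) \<in> L" by (rule lin) (use e1 e3 in auto)
      moreover have "\<exists>w\<in>V. (1 - t) * e3 w + (- t) * e1 w \<noteq> 0"
        using tt a e1 e3 by (cases "t = 1") force+
      ultimately show "P (\<lambda>v. (1 - t) * e3 v + t * (- e1 v))"
        using tt e1 e3 by (simp add: P_def split_iff mult.commute)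
    qed
  qed
  then obtain x where "P x" "median (x b1) (x b2) (x b3) = 0" by blast
  then show ?thesis using median_zero_sign_split[of x b1 b2 b3] unfolding P_def by blast
qed

text \<open>
  A pair gets the pattern from the linear condition that its two coefficients sum to $0$. These
  conditions and the $D$ equations of a relation leave dimension at least $3$, enough for two
  triples.
\<close>
lemma relation_with_sign_splits:
  fixes h :: "'v \<Rightarrow> nat \<Rightarrow> real"
  assumes fin: "finite V" "finite I" and card: "D + card I + 2 < card V"
    and a: "a1 \<in> V" "a2 \<in> V" "a3 \<in> V" "a1 \<noteq> a2" "a1 \<noteq> a3" "a2 \<noteq> a3"
    and pq: "\<And>i. i \<in> I \<Longrightarrow> p i \<in> V \<and> q i \<in> V"
  shows "\<exists>x. linear_relation D h V x \<and> (\<exists>v\<in>V. x v \<noteq> 0) \<and>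
    sign_split x {a1, a2, a3} \<and> sign_split x {b1, b2, b3} \<and> (\<forall>i\<in>I. sign_split x {p i, q i})"
proof -
  define L where "L = {x. linear_relation D h V x \<and> (\<forall>i\<in>I. x (p i) + x (q i) = 0)}"
  have "\<exists>x\<in>L. (\<exists>w\<in>V. x w \<noteq> 0) \<and> sign_split x {a1, a2, a3} \<and> sign_split x {b1, b2, b3}"
  proof (rule sign_split_two_triples[OF _ _ a])
    fix x y s t assume xy: "x \<in> L" "y \<in> L"
    have "s * x (p i) + t * y (p i) + (s * x (q i) + t * y (q i))
        = s * (x (p i) + x (q i)) + t * (y (p i) + y (q i))" for i
      by (simp add: algebra_simps)
    then show "(\<lambda>v. s * x v + t * y v) \<in> L"
      using xy linear_relation_combine[of D h V x y s t] by (simp add: L_def)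
  next
    fix u v assume uv: "u \<in> V" "v \<in> V"
    \<comment> \<open>One linear system collects the \<open>D\<close> equations of a relation, the pair conditions and
      the vanishing at \<open>u\<close> and \<open>v\<close>.\<close>
    define J where "J = {..<D} <+> (I <+> {u, v})"
    define M where "M = case_sum (\<lambda>m w. h w m)
      (case_sum (\<lambda>i w. of_bool (w = p i) + of_bool (w = q i)) (\<lambda>z w. of_bool (w = z)))"
    have "card {u, v} \<le> 2" by (simp add: card_insert_if)
    then have "card J < card V" using card fin by (simp add: J_def card_Plus)
    then obtain x where x: "\<exists>w\<in>V. x w \<noteq> 0" "\<forall>j\<in>J. (\<Sum>w\<in>V. M j w * x w) = 0"
      using homogeneous_system_nontrivial_solution[of J V M] fin by (auto simp: J_def)
    have ind: "(\<Sum>w\<in>V. of_bool (w = z) * x w) = x z" if "z \<in> V" for z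
    proof -
      have "(\<Sum>w\<in>V. of_bool (w = z) * x w) = (\<Sum>w\<in>V. if w = z then x w else 0)"
        by (rule sum.cong) auto
      then show ?thesis using fin that by simp
    qed
    have 1: "(\<Sum>w\<in>V. x w * h w m) = 0" if "m < D" for m
    proof -
      have "Inl m \<in> J" using that by (auto simp: J_def)
      then show ?thesis using x(2) by (fastforce simp: M_def mult.commute)
    qed
    have 2: "x (p i) + x (q i) = 0" if "i \<in> I" for i
    proof -
      have "Inr (Inl i) \<in> J" using that by (auto simp: J_def)
      then have "(\<Sum>w\<in>V. M (Inr (Inl i)) w * x w) = 0" using x(2) by blast
      then show ?thesis using pq[OF that] ind by (simp add: M_def distrib_right sum.distrib)
    qed
    have 3: "x z = 0" if "z \<in> {u, v}" for z
    proof -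
      have "Inr (Inr z) \<in> J" using that by (auto simp: J_def)
      then have "(\<Sum>w\<in>V. M (Inr (Inr z)) w * x w) = 0" using x(2) by blast
      then show ?thesis using ind[of z] that uv by (auto simp: M_def)
    qed
    show "\<exists>x\<in>L. (\<exists>w\<in>V. x w \<noteq> 0) \<and> x u = 0 \<and> x v = 0"
      using 1 2 3 x(1) by (intro bexI[of _ x]) (auto simp: L_def linear_relation_def)
  qed
  moreover have "sign_split x {p i, q i}" if "x (p i) + x (q i) = 0" for x :: "'v \<Rightarrow> real" and i
  proof -
    have "x (q i) = - x (p i)" using that by simp
    then show ?thesis by (auto simp: sign_split_def)
  qed
  ultimately show ?thesis unfolding L_def by blast
qed

section \<open>From relations to crossings\<close>

text \<open>Sums over the $d+1$ homogeneous coordinates are to be treated as a whole.\<close>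
declare sum.lessThan_Suc [simp del]

text \<open>
  Homogeneous coordinates: the additional coordinate $1$ makes affine relations linear ones.
\<close>
definition homogeneous :: "nat \<Rightarrow> point \<Rightarrow> nat \<Rightarrow> real" where
  "homogeneous d x m = (if m < d then Poly_Mapping.lookup x m else 1)"

lemma lookup_scaleR_poly_mapping:
  "Poly_Mapping.lookup (r *\<^sub>R x) i = r *\<^sub>R Poly_Mapping.lookup x i"
proof -
  have "finite {i. r *\<^sub>R Poly_Mapping.lookup x i \<noteq> 0}"
    by (rule finite_subset[OF _ finite_keys[of x]]) (auto simp: in_keys_iff)
  then show ?thesis by (simp add: scaleR_poly_mapping_def lookup_Abs_poly_mapping)
qed

lemma continuous_on_lookup:
  "continuous_on S (\<lambda>x :: 'a \<Rightarrow>\<^sub>0 'b::real_normed_vector. Poly_Mapping.lookup x i)"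
proof -
  have "norm (Poly_Mapping.lookup x i) \<le> norm x" for x :: "'a \<Rightarrow>\<^sub>0 'b"
  proof (cases "i \<in> Poly_Mapping.keys x")
    case True
    have "norm (Poly_Mapping.lookup x i) \<le> (\<Sum>n\<in>Poly_Mapping.keys x. norm (Poly_Mapping.lookup x n))"
      by (rule member_le_sum) (use True in auto)
    then show ?thesis by (simp add: norm_poly_mapping_def dist_poly_mapping_def)
  qed (simp add: in_keys_iff)
  then have "bounded_linear (\<lambda>x :: 'a \<Rightarrow>\<^sub>0 'b. Poly_Mapping.lookup x i)"
    by (intro bounded_linear_intro[of _ 1]) (simp_all add: lookup_add lookup_scaleR_poly_mapping)
  then show ?thesis by (rule bounded_linear.continuous_on) (rule continuous_on_id)
qed

lemma homogeneous_affine_combination: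
  assumes "finite S" "sum u S = 1"
  shows "homogeneous d (\<Sum>v\<in>S. u v *\<^sub>R p v) m = (\<Sum>v\<in>S. u v * homogeneous d (p v) m)"
  using assms by (simp add: homogeneous_def lookup_sum lookup_scaleR_poly_mapping)

text \<open>
  A functional $\sum_{m<d}a_mx_m+a_d$ that vanishes on $d+1$ points would describe a hyperplane
  through them or, if $a_m=0$ for all $m<d$, be the zero functional.
\<close>
lemma general_position_functional_nonzero:
  assumes gp: "general_position d P" and P: "P \<subseteq> Rspace d"
    and S: "S \<subseteq> P" "card S = Suc d" and a: "\<exists>m<Suc d. a m \<noteq> 0"
  shows "\<exists>x\<in>S. (\<Sum>m<Suc d. a m * homogeneous d x m) \<noteq> 0"
proof (rule ccontr)
  assume "\<not> ?thesis"
  then have zero: "(\<Sum>m<d. a m * Poly_Mapping.lookup x m) = - a d" if "x \<in> S" for x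
    using that by (simp add: homogeneous_def eq_neg_iff_add_eq_0 sum.lessThan_Suc)
  have "\<not> (\<exists>i<d. a i \<noteq> 0)"
  proof
    assume ne: "\<exists>i<d. a i \<noteq> 0"
    define H where "H = {x \<in> Rspace d. (\<Sum>i<d. a i * Poly_Mapping.lookup x i) = - a d}"
    have "is_hyperplane d H" unfolding is_hyperplane_def H_def using ne by blast
    moreover have "S \<subseteq> H" using zero S P by (auto simp: H_def)
    ultimately show False using gp S unfolding general_position_def by (metis Suc_eq_plus1)
  qed
  moreover obtain x where "x \<in> S" using S(2) by fastforce
  ultimately have "a d = 0" using zero[of x] by simp
  then show False using a \<open>\<not> (\<exists>i<d. a i \<noteq> 0)\<close> by (auto simp: less_Suc_eq)
qed

text \<open>
  Barycentric coordinates as globally defined affine functionals. Extend \<open>S\<close> to $d+1$ points;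
  the $d$ points other than \<open>k\<close> impose $d$ linear conditions on the $d+1$ coefficients of
  a functional, and general position prevents a nonzero solution from vanishing at \<open>k\<close> as well.
\<close>
lemma barycentric_functional:
  assumes gp: "general_position d P" and P: "P \<subseteq> Rspace d" "finite P" "Suc d \<le> card P"
    and S: "S \<subseteq> P" "card S \<le> Suc d" "k \<in> S"
  shows "\<exists>a. \<forall>x\<in>S. (\<Sum>m<Suc d. a m * homogeneous d x m) = of_bool (x = k)"
proof -
  obtain S' where S': "S \<subseteq> S'" "S' \<subseteq> P" "card S' = Suc d"
    using exists_subset_between[of S "Suc d" P] P S by auto
  have fS': "finite S'" "k \<in> S'" using S' P S finite_subset by auto
  have "card (S' - {k}) < card {..<Suc d}" using S' fS' by simp
  from homogeneous_system_nontrivial_solution[OF _ _ this, of "homogeneous d"] fS'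
  obtain a where a: "\<exists>m<Suc d. a m \<noteq> 0"
    "\<forall>x\<in>S' - {k}. (\<Sum>m<Suc d. homogeneous d x m * a m) = 0" by auto
  define l where "l x = (\<Sum>m<Suc d. a m * homogeneous d x m)" for x
  have l0: "l x = 0" if "x \<in> S' - {k}" for x
    using a(2) that by (simp add: l_def mult.commute)
  obtain x where "x \<in> S'" "l x \<noteq> 0"
    using general_position_functional_nonzero[OF gp P(1) S'(2,3) a(1)] by (auto simp: l_def)
  then have lk: "l k \<noteq> 0" using l0 by blast
  have "(\<Sum>m<Suc d. a m / l k * homogeneous d x m) = l x / l k" for x
    unfolding l_def sum_divide_distrib by (rule sum.cong) auto
  moreover have "l x / l k = of_bool (x = k)" if "x \<in> S" for x
    using l0[of x] that S' lk by (cases "x = k") auto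
  ultimately show ?thesis by (intro exI[of _ "\<lambda>m. a m / l k"]) auto
qed

text \<open>
  Applied to a relation, the barycentric functional of a vertex returns its coefficient.
\<close>
lemma uniform_homogeneous:
  assumes gp: "general_position d (p ` V)" and V: "p ` V \<subseteq> Rspace d" "finite V" "Suc d \<le> card V"
    and inj: "inj_on p V"
  shows "uniform (Suc d) (\<lambda>v. homogeneous d (p v)) V"
  unfolding uniform_def
proof (intro allI impI ballI)
  fix S x k
  assume S: "S \<subseteq> V" "card S \<le> Suc d" "k \<in> S"
    and rel: "linear_relation (Suc d) (\<lambda>v. homogeneous d (p v)) S x"
  have fS: "finite S" using S V finite_subset by auto
  have "card (p ` V) = card V" "card (p ` S) = card S"
    using inj S(1) by (auto intro: card_image inj_on_subset)
  then have "\<exists>a. \<forall>y\<in>p ` S. (\<Sum>m<Suc d. a m * homogeneous d y m) = of_bool (y = p k)"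
    by (intro barycentric_functional[OF gp V(1)]) (use V S in auto)
  then obtain a where a: "\<forall>y\<in>p ` S. (\<Sum>m<Suc d. a m * homogeneous d y m) = of_bool (y = p k)"
    by blast
  have "x k = (\<Sum>v\<in>S. if v = k then x v else 0)" using fS S(3) by simp
  also have "\<dots> = (\<Sum>v\<in>S. x v * (\<Sum>m<Suc d. a m * homogeneous d (p v) m))"
  proof (rule sum.cong)
    fix v assume v: "v \<in> S"
    have "p v = p k \<longleftrightarrow> v = k" using inj S v by (auto dest: inj_onD)
    then show "(if v = k then x v else 0) = x v * (\<Sum>m<Suc d. a m * homogeneous d (p v) m)"
      using a v by simp
  qed simp
  also have "\<dots> = (\<Sum>m<Suc d. a m * (\<Sum>v\<in>S. x v * homogeneous d (p v) m))"
    unfolding sum_distrib_left by (subst sum.swap) (simp only: mult.left_commute)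
  also have "\<dots> = 0" using rel by (simp add: linear_relation_def)
  finally show "x k = 0" .
qed

text \<open>
  The ambient space of finitely supported sequences is infinite-dimensional, so the relative
  neighbourhood is built by hand: it is the set where the barycentric functionals, which are
  continuous, are positive.
\<close>
lemma positive_combination_in_rel_interior:
  fixes p :: "'v \<Rightarrow> point"
  assumes gp: "general_position d (p ` V)" and V: "p ` V \<subseteq> Rspace d" "finite V" "Suc d \<le> card V"
    and inj: "inj_on p V" and E: "E \<subseteq> V" "card E \<le> Suc d"
    and w: "\<And>v. v \<in> E \<Longrightarrow> 0 < w v" "sum w E = 1"
  shows "(\<Sum>v\<in>E. w v *\<^sub>R p v) \<in> rel_interior (convex hull (p ` E))"
proof -
  have fE: "finite E" using E V finite_subset by auto
  have injE: "inj_on p E" using inj E(1) by (rule inj_on_subset)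
  have cards: "card (p ` V) = card V" "card (p ` E) = card E"
    using inj injE by (auto intro: card_image)
  have "\<exists>a. \<forall>y\<in>p ` E. (\<Sum>m<Suc d. a m * homogeneous d y m) = of_bool (y = k)"
    if "k \<in> p ` E" for k
    by (rule barycentric_functional[OF gp V(1)]) (use V E that cards in auto)
  then have "\<exists>a. \<forall>k\<in>p ` E. \<forall>y\<in>p ` E. (\<Sum>m<Suc d. a k m * homogeneous d y m) = of_bool (y = k)"
    by (intro bchoice ballI)
  then obtain a where a: "\<And>k y. k \<in> p ` E \<Longrightarrow> y \<in> p ` E \<Longrightarrow>
      (\<Sum>m<Suc d. a k m * homogeneous d y m) = of_bool (y = k)" by blast
  define \<beta> where "\<beta> k x = (\<Sum>m<Suc d. a k m * homogeneous d x m)" for k x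
  have \<beta>: "\<beta> k (\<Sum>x\<in>p ` E. u x *\<^sub>R x) = u k" if k: "k \<in> p ` E" and u: "sum u (p ` E) = 1" for k u
  proof -
    have "\<beta> k (\<Sum>x\<in>p ` E. u x *\<^sub>R x)
        = (\<Sum>m<Suc d. \<Sum>x\<in>p ` E. u x * (a k m * homogeneous d x m))"
      unfolding \<beta>_def homogeneous_affine_combination[OF finite_imageI[OF fE] u, of d "\<lambda>x. x"]
        sum_distrib_left by (simp only: mult.left_commute)
    also have "\<dots> = (\<Sum>x\<in>p ` E. u x * \<beta> k x)"
      unfolding \<beta>_def sum_distrib_left by (rule sum.swap)
    also have "\<dots> = (\<Sum>x\<in>p ` E. if x = k then u x else 0)"
      by (rule sum.cong) (use a k in \<open>auto simp: \<beta>_def\<close>)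
    also have "\<dots> = u k" using fE k by simp
    finally show ?thesis .
  qed
  have "continuous_on UNIV (\<lambda>x. homogeneous d x m)" for m
    by (cases "m < d") (simp_all add: homogeneous_def continuous_on_lookup)
  then have cont: "continuous_on UNIV (\<beta> k)" for k
    unfolding \<beta>_def by (intro continuous_intros)
  define U where "U = (\<Inter>k\<in>p ` E. {x. 0 < \<beta> k x})"
  have "open U" unfolding U_def
    by (intro open_INT finite_imageI fE ballI open_Collect_less continuous_on_const cont)
  define u where "u = (\<lambda>x. w (inv_into E p x))"
  have u_p: "u (p v) = w v" if "v \<in> E" for v using that injE by (simp add: u_def)
  have sum_u: "sum u (p ` E) = 1"
    using w(2) u_p by (simp add: sum.reindex[OF injE])
  have comb: "(\<Sum>v\<in>E. w v *\<^sub>R p v) = (\<Sum>x\<in>p ` E. u x *\<^sub>R x)"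
    using u_p by (simp add: sum.reindex[OF injE])
  have u_pos: "0 < u x" if "x \<in> p ` E" for x using that u_p w(1) by auto
  have "(\<Sum>x\<in>p ` E. u x *\<^sub>R x) \<in> U" using \<beta>[OF _ sum_u] u_pos by (simp add: U_def)
  moreover have "(\<Sum>x\<in>p ` E. u x *\<^sub>R x) \<in> convex hull (p ` E)"
  proof -
    have "\<forall>x\<in>p ` E. 0 \<le> u x" using u_pos by (simp add: less_imp_le)
    then show ?thesis unfolding convex_hull_finite[OF finite_imageI[OF fE]] using sum_u by blast
  qed
  moreover have "U \<inter> affine hull (convex hull (p ` E)) \<subseteq> convex hull (p ` E)"
  proof
    fix y assume y: "y \<in> U \<inter> affine hull (convex hull (p ` E))"
    then obtain v where v: "sum v (p ` E) = 1" "y = (\<Sum>x\<in>p ` E. v x *\<^sub>R x)"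
      using fE by (auto simp: affine_hull_finite)
    have "0 \<le> v x" if "x \<in> p ` E" for x
    proof -
      have "0 < \<beta> x y" using y that unfolding U_def by blast
      then show ?thesis using \<beta>[OF that v(1)] v(2) by simp
    qed
    then show "y \<in> convex hull (p ` E)"
      unfolding convex_hull_finite[OF finite_imageI[OF fE]] using v by blast
  qed
  ultimately show ?thesis unfolding comb mem_rel_interior using \<open>open U\<close> by blast
qed

text \<open>
  Moving the negative terms to the other side turns the relation into two positive combinations
  with the same value. Their total weights agree by the last homogeneous coordinate, so that both
  become affine after division by this weight.
\<close>
lemma crossing_of_signed_relation:
  fixes p :: "'v \<Rightarrow> point"
  assumes gp: "general_position d (p ` V)" and V: "p ` V \<subseteq> Rspace d" "finite V" "Suc d \<le> card V"
    and inj: "inj_on p V"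
    and ef: "e \<subseteq> V" "f \<subseteq> V" "e \<inter> f = {}" "card e \<le> Suc d" "card f \<le> Suc d" "e \<noteq> {}"
    and rel: "linear_relation (Suc d) (\<lambda>v. homogeneous d (p v)) (e \<union> f) y"
    and pos: "\<And>v. v \<in> e \<Longrightarrow> 0 < y v" and neg: "\<And>v. v \<in> f \<Longrightarrow> y v < 0"
  shows "crossing p e f"
proof -
  have fin: "finite e" "finite f" using ef(1,2) V(2) by (auto intro: finite_subset)
  have split: "(\<Sum>v\<in>e. y v * homogeneous d (p v) m) = (\<Sum>v\<in>f. - y v * homogeneous d (p v) m)"
    if "m < Suc d" for m
  proof -
    have "(\<Sum>v\<in>e. y v * homogeneous d (p v) m) + (\<Sum>v\<in>f. y v * homogeneous d (p v) m) = 0"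
      using rel that sum.union_disjoint[OF fin ef(3), of "\<lambda>v. y v * homogeneous d (p v) m"]
      by (simp add: linear_relation_def)
    then show ?thesis by (simp add: sum_negf)
  qed
  define s where "s = sum y e"
  have "0 < s" unfolding s_def by (rule sum_pos) (use fin ef pos in auto)
  have s_f: "s = (\<Sum>v\<in>f. - y v)" using split[of d] by (simp add: s_def homogeneous_def)
  have in_R: "Poly_Mapping.lookup (p v) m = 0" if "v \<in> V" "\<not> m < d" for v m
  proof -
    have "Poly_Mapping.keys (p v) \<subseteq> {..<d}" using V(1) that(1) by (auto simp: Rspace_def)
    then show ?thesis using that(2) by (auto simp: in_keys_iff)
  qed
  have "(\<Sum>v\<in>e. (y v / s) *\<^sub>R p v) = (\<Sum>v\<in>f. (- y v / s) *\<^sub>R p v)"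
  proof (rule poly_mapping_eqI)
    fix m
    show "Poly_Mapping.lookup (\<Sum>v\<in>e. (y v / s) *\<^sub>R p v) m
        = Poly_Mapping.lookup (\<Sum>v\<in>f. (- y v / s) *\<^sub>R p v) m"
    proof (cases "m < d")
      case True
      have "(\<Sum>v\<in>e. y v * homogeneous d (p v) m) / s = (\<Sum>v\<in>f. - y v * homogeneous d (p v) m) / s"
        using split[of m] True by simp
      then show ?thesis
        using True by (simp add: lookup_sum lookup_scaleR_poly_mapping homogeneous_def sum_divide_distrib)
    next
      case False
      have "Poly_Mapping.lookup (\<Sum>v\<in>g. c v *\<^sub>R p v) m = 0" if "g \<subseteq> V" for g c
        unfolding lookup_sum lookup_scaleR_poly_mapping
        by (rule sum.neutral) (use in_R False that in auto)
      then show ?thesis using ef(1,2) by metis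
    qed
  qed
  moreover have "(\<Sum>v\<in>e. (y v / s) *\<^sub>R p v) \<in> rel_interior (convex hull (p ` e))"
    by (rule positive_combination_in_rel_interior[OF gp V inj])
      (use ef pos \<open>0 < s\<close> in \<open>auto simp: s_def simp flip: sum_divide_distrib\<close>)
  moreover have "(\<Sum>v\<in>f. (- y v / s) *\<^sub>R p v) \<in> rel_interior (convex hull (p ` f))"
  proof (rule positive_combination_in_rel_interior[OF gp V inj])
    show "(\<Sum>v\<in>f. - y v / s) = 1" 
      unfolding sum_divide_distrib[symmetric] s_f[symmetric] using \<open>0 < s\<close> by simp
    show "0 < - y v / s" if "v \<in> f" for v
      using neg[OF that] \<open>0 < s\<close> by (simp add: divide_neg_pos)
  qed (use ef in auto)
  ultimately show ?thesis using ef(3) unfolding crossing_def by auto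
qed

section \<open>Existence of drawings\<close>
definition moment_curve :: "nat \<Rightarrow> real \<Rightarrow> point" where
  "moment_curve d t = (\<Sum>i<d. Poly_Mapping.single i (t ^ Suc i))"

lemma lookup_moment_curve:
  "Poly_Mapping.lookup (moment_curve d t) m = (if m < d then t ^ Suc m else 0)"
proof -
  have "Poly_Mapping.lookup (moment_curve d t) m = (\<Sum>i<d. if i = m then t ^ Suc i else 0)"
    unfolding moment_curve_def lookup_sum by (rule sum.cong) (auto simp: lookup_single)
  then show ?thesis by simp
qed

lemma moment_curve_Rspace: "moment_curve d t \<in> Rspace d"
  by (auto simp: Rspace_def in_keys_iff lookup_moment_curve split: if_splits)

text \<open>
  A hyperplane that contains $d+1$ points of the curve gives a nonzero polynomial of degree at most
  $d$ with $d+1$ roots.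
\<close>
lemma general_position_moment_curve: "general_position d (range (moment_curve d))"
  unfolding general_position_def
proof (intro allI impI notI)
  fix S assume S: "S \<subseteq> range (moment_curve d)" "card S = d + 1"
    and "\<exists>h. is_hyperplane d h \<and> S \<subseteq> h"
  then obtain h where "is_hyperplane d h" "S \<subseteq> h" by blast
  then obtain a b where ab: "(\<exists>i<d. a i \<noteq> 0) \<and>
      h = {x \<in> Rspace d. (\<Sum>i<d. a i * Poly_Mapping.lookup x i) = b}"
    unfolding is_hyperplane_def by (elim exE) (rule that)
  note a = conjunct1[OF ab] and h = conjunct2[OF ab]
  have on: "(\<Sum>i<d. a i * Poly_Mapping.lookup x i) = b" if "x \<in> S" for x
    using \<open>S \<subseteq> h\<close> that unfolding h by auto
  obtain T where T: "S = moment_curve d ` T" "inj_on (moment_curve d) T"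
    using iffD1[OF subset_image_inj S(1)] by (elim exE conjE)
  define q where "q = (\<Sum>i<d. monom (a i) (Suc i)) - [:b:]"
  have "poly q t = 0" if "t \<in> T" for t
    using on[of "moment_curve d t"] T that
    by (simp add: q_def poly_sum poly_monom lookup_moment_curve)
  moreover have "card T = d + 1" using card_image[OF T(2)] S(2) by (simp add: T(1))
  moreover have "q \<noteq> 0"
  proof
    assume "q = 0"
    obtain i where i: "i < d" "a i \<noteq> 0" using a by auto
    have "coeff q (Suc i) = a i"
      using i by (simp add: q_def coeff_sum)
    then show False using \<open>q = 0\<close> i by simp
  qed
  moreover have "degree q \<le> d"
    unfolding q_def by (intro degree_diff_le degree_sum_le)
      (auto intro: order.trans[OF degree_monom_le])
  moreover have "card T \<le> degree q" if "q \<noteq> 0" "\<And>t. t \<in> T \<Longrightarrow> poly q t = 0"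
  proof -
    have "card T \<le> card {t. poly q t = 0}"
      by (rule card_mono) (use that poly_roots_finite in auto)
    also have "\<dots> \<le> degree q" using that(1) by (rule card_poly_roots_bound)
    finally show ?thesis .
  qed
  ultimately show False by fastforce
qed

lemma inj_moment_curve: "0 < d \<Longrightarrow> inj (moment_curve d)"
proof (rule injI)
  fix s t assume "0 < d" "moment_curve d s = moment_curve d t"
  then have "Poly_Mapping.lookup (moment_curve d s) 0 = Poly_Mapping.lookup (moment_curve d t) 0"
    by simp
  then show "s = t" using \<open>0 < d\<close> by (simp add: lookup_moment_curve)
qed

lemma rectilinear_drawing_exists:
  fixes V :: "'v::countable set"
  assumes "0 < d" "finite V" "Suc d \<le> card V" and E: "\<And>e. e \<in> E \<Longrightarrow> e \<subseteq> V \<and> card e \<le> Suc d"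
  shows "\<exists>p. rectilinear_drawing d V E p"
proof -
  define p where "p v = moment_curve d (real (to_nat v))" for v :: 'v
  have inj: "inj_on p S" for S
    by (rule inj_onI) (use injD[OF inj_moment_curve[OF assms(1)]] in \<open>force simp: p_def\<close>)
  have R: "p ` V \<subseteq> Rspace d" by (auto simp: p_def moment_curve_Rspace)
  have gp: "general_position d (p ` V)"
  proof -
    have "p ` V \<subseteq> range (moment_curve d)" by (auto simp: p_def)
    then show ?thesis
      using general_position_moment_curve[of d] unfolding general_position_def
      by (meson subset_trans)
  qed
  have "\<not> affine_dependent (p ` e)" if e: "e \<in> E" for e
  proof
    assume "affine_dependent (p ` e)"
    moreover have fe: "finite e" using E[OF e] assms(2) by (auto intro: finite_subset)
    ultimately obtain U where U: "sum U (p ` e) = 0" "\<exists>v\<in>p ` e. U v \<noteq> 0" "(\<Sum>v\<in>p ` e. U v *\<^sub>R v) = 0"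
      by (auto simp: affine_dependent_explicit_finite)
    have "(\<Sum>v\<in>e. U (p v) * homogeneous d (p v) m) = 0" for m
    proof (cases "m < d")
      case True
      have "Poly_Mapping.lookup (\<Sum>v\<in>e. U (p v) *\<^sub>R p v) m = 0"
        using U(3) by (simp add: sum.reindex[OF inj])
      then show ?thesis
        using True by (simp add: homogeneous_def lookup_sum lookup_scaleR_poly_mapping)
    next
      case False
      then show ?thesis using U(1) by (simp add: homogeneous_def sum.reindex[OF inj])
    qed
    then have "linear_relation (Suc d) (\<lambda>v. homogeneous d (p v)) e (\<lambda>v. U (p v))"
      by (simp add: linear_relation_def)
    then have "\<forall>v\<in>e. U (p v) = 0"
      using uniform_homogeneous[OF gp R assms(2,3) inj] E[OF e] unfolding uniform_def by blast
    then show False using U(2) by auto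
  qed
  then show ?thesis unfolding rectilinear_drawing_def using inj R gp by blast
qed

section \<open>Counting crossings in balanced hypergraphs\<close>
lemma balanced_vertices_eq: "balanced_vertices d n = {..<d} \<times> {..<n}"
  by (auto simp: balanced_vertices_def part_def)

lemma uniform_subset: "uniform D h V \<Longrightarrow> S \<subseteq> V \<Longrightarrow> uniform D h S"
  unfolding uniform_def by blast

text \<open>
  The selection has $2d+2$ vertices, one more than the $(d+1)+(d-2)+2$ conditions that
  \<open>relation_with_sign_splits\<close> can satisfy. From the resulting relation each part retains a vertex
  with coefficient $\ge 0$ and another one with coefficient $\le 0$ that include all nonzero ones of
  the part; a perturbation makes these signs strict, and the two choices form the hyperedges.
\<close>
lemma crossing_in_selection:
  assumes d: "2 \<le> d" and n: "3 \<le> n"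
    and draw: "rectilinear_drawing d (balanced_vertices d n) (balanced_edges d n) p"
    and g: "\<And>i. i < d \<Longrightarrow> g i \<subseteq> {..<n}" "\<And>i. i < d \<Longrightarrow> card (g i) = (if i < 2 then 3 else 2)"
  shows "\<exists>e\<in>balanced_edges d n. \<exists>f\<in>balanced_edges d n.
    e \<union> f \<subseteq> Sigma {..<d} g \<and> crossing p e f"
proof -
  define B where "B = balanced_vertices d n"
  define V where "V = Sigma {..<d} g"
  define h where "h = (\<lambda>v. homogeneous d (p v))"
  have B: "finite B" "V \<subseteq> B" using g(1) by (auto simp: B_def V_def balanced_vertices_eq)
  have "d + 1 \<le> d * 3" using d by simp
  also have "\<dots> \<le> d * n" using n by simp
  finally have cardB: "Suc d \<le> card B" by (simp add: B_def balanced_vertices_eq)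
  have gp: "general_position d (p ` B)" "p ` B \<subseteq> Rspace d" "inj_on p B"
    using draw by (auto simp: rectilinear_drawing_def B_def)
  have uni: "uniform (Suc d) h B"
    unfolding h_def by (rule uniform_homogeneous[OF gp(1,2) B(1) cardB gp(3)])
  have fin_g: "finite (g i)" if "i < d" for i using g(1)[OF that] finite_subset by blast
  have finV: "finite V" using B finite_subset by blast
  obtain k where k: "d = Suc (Suc k)" using d by (metis add_2_eq_Suc le_Suc_ex)
  have "card V = (\<Sum>i<d. if i < 2 then 3 else 2)"
    unfolding V_def using g(2) fin_g by simp
  also have "\<dots> = 2 * d + 2" unfolding k by (simp add: sum.lessThan_Suc_shift)
  finally have cardV: "card V = 2 * d + 2" .
  obtain a1 a2 a3 where a: "g 0 = {a1, a2, a3}" "a1 \<noteq> a2" "a1 \<noteq> a3" "a2 \<noteq> a3"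
    using g(2)[of 0] d by (auto simp: card_3_iff)
  obtain b1 b2 b3 where b: "g 1 = {b1, b2, b3}"
    using g(2)[of 1] d by (auto simp: card_3_iff)
  have "\<forall>i\<in>{2..<d}. \<exists>r s. g i = {r, s}"
  proof
    fix i assume "i \<in> {2..<d}"
    then have "card (g i) = 2" using g(2)[of i] by simp
    then show "\<exists>r s. g i = {r, s}" by (auto simp: card_2_iff)
  qed
  from bchoice[OF this] obtain r where "\<forall>i\<in>{2..<d}. \<exists>s. g i = {r i, s}" by (elim exE) (rule that)
  from bchoice[OF this] obtain s where rs: "\<forall>i\<in>{2..<d}. g i = {r i, s i}" by (elim exE) (rule that)
  have "\<exists>x. linear_relation (Suc d) h V x \<and> (\<exists>v\<in>V. x v \<noteq> 0) \<and>
      sign_split x {(0, a1), (0, a2), (0, a3)} \<and> sign_split x {(1, b1), (1, b2), (1, b3)} \<and>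
      (\<forall>i\<in>{2..<d}. sign_split x {(i, r i), (i, s i)})"
  proof (rule relation_with_sign_splits[OF finV])
    show "Suc d + card {2..<d} + 2 < card V" using cardV d by simp
    show "(i, r i) \<in> V \<and> (i, s i) \<in> V" if "i \<in> {2..<d}" for i
      using rs that by (auto simp: V_def)
  qed (use a d in \<open>auto simp: V_def\<close>)
  then obtain x where x: "linear_relation (Suc d) h V x" "\<exists>v\<in>V. x v \<noteq> 0"
    "sign_split x {(0, a1), (0, a2), (0, a3)}" "sign_split x {(1, b1), (1, b2), (1, b3)}"
    "\<forall>i\<in>{2..<d}. sign_split x {(i, r i), (i, s i)}"
    by blast
  have slice: "sign_split x ({i} \<times> g i)" if "i < d" for i
  proof -
    have "i = 0 \<or> i = 1 \<or> i \<in> {2..<d}" using that by auto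
    then show ?thesis using x(3-5) a(1) b rs by auto
  qed
  have "\<forall>i\<in>{..<d}. \<exists>P Q. P \<in> {i} \<times> g i \<and> Q \<in> {i} \<times> g i \<and> P \<noteq> Q \<and> 0 \<le> x P \<and> x Q \<le> 0 \<and>
      (\<forall>v\<in>{i} \<times> g i - {P, Q}. x v = 0)"
  proof
    fix i assume i: "i \<in> {..<d}"
    then have "2 \<le> card ({i} \<times> g i)" using g(2)[of i] by (simp add: card_cartesian_product_singleton)
    from sign_split_poles[OF slice this] i
    obtain P Q where "P \<in> {i} \<times> g i" "Q \<in> {i} \<times> g i" "P \<noteq> Q" "0 \<le> x P" "x Q \<le> 0"
      "\<And>v. v \<in> {i} \<times> g i - {P, Q} \<Longrightarrow> x v = 0" by (metis lessThan_iff)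
    then show "\<exists>P Q. P \<in> {i} \<times> g i \<and> Q \<in> {i} \<times> g i \<and> P \<noteq> Q \<and> 0 \<le> x P \<and> x Q \<le> 0 \<and>
      (\<forall>v\<in>{i} \<times> g i - {P, Q}. x v = 0)" by blast
  qed
  from bchoice[OF this] obtain P where
    "\<forall>i\<in>{..<d}. \<exists>Q. P i \<in> {i} \<times> g i \<and> Q \<in> {i} \<times> g i \<and> P i \<noteq> Q \<and> 0 \<le> x (P i) \<and> x Q \<le> 0 \<and>
      (\<forall>v\<in>{i} \<times> g i - {P i, Q}. x v = 0)" by (elim exE) (rule that)
  from bchoice[OF this] obtain Q where
    PQ: "\<forall>i\<in>{..<d}. P i \<in> {i} \<times> g i \<and> Q i \<in> {i} \<times> g i \<and> P i \<noteq> Q i \<and> 0 \<le> x (P i) \<and> x (Q i) \<le> 0 \<and>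
      (\<forall>v\<in>{i} \<times> g i - {P i, Q i}. x v = 0)" by (elim exE) (rule that)
  define e where "e = P ` {..<d}"
  define f where "f = Q ` {..<d}"
  have fst: "fst (P i) = i" "fst (Q i) = i" if "i < d" for i
  proof -
    have "P i \<in> {i} \<times> g i" "Q i \<in> {i} \<times> g i" using PQ that by blast+
    then show "fst (P i) = i" "fst (Q i) = i" by auto
  qed
  have "P i \<in> V \<and> Q i \<in> V" if "i < d" for i
  proof -
    have "P i \<in> {i} \<times> g i" "Q i \<in> {i} \<times> g i" using PQ that by blast+
    then show ?thesis using that by (auto simp: V_def)
  qed
  then have sub: "e \<subseteq> V" "f \<subseteq> V" by (auto simp: e_def f_def)
  have disj: "e \<inter> f = {}"
  proof (rule ccontr)
    assume "e \<inter> f \<noteq> {}"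
    then obtain v where "v \<in> e" "v \<in> f" by blast
    then obtain i j where ij: "i < d" "j < d" "P i = Q j" unfolding e_def f_def by blast
    then have "i = j" using fst by metis
    then show False using ij PQ by blast
  qed
  have edge: "R ` {..<d} \<in> balanced_edges d n"
    if R: "\<And>i. i < d \<Longrightarrow> R i \<in> V \<and> fst (R i) = i" for R
    unfolding balanced_edges_def
  proof (intro CollectI conjI allI impI)
    show "R ` {..<d} \<subseteq> balanced_vertices d n" using R B(2) by (auto simp: B_def)
    have "inj_on R {..<d}" by (rule inj_onI) (use R in \<open>metis lessThan_iff\<close>)
    then show "card (R ` {..<d}) = d" by (simp add: card_image)
    fix i assume i: "i < d"
    have "R i \<in> part n i"
    proof -
      have "snd (R i) < n" using R[OF i] B(2) by (auto simp: B_def balanced_vertices_eq)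
      then show ?thesis using R[OF i] by (cases "R i") (auto simp: part_def)
    qed
    moreover have "j = i" if "j < d" "R j \<in> part n i" for j
      using R[OF that(1)] that(2) by (auto simp: part_def)
    ultimately have "R ` {..<d} \<inter> part n i = {R i}" using i by blast
    then show "card (R ` {..<d} \<inter> part n i) = 1" by simp
  qed
  have edges: "e \<in> balanced_edges d n" "f \<in> balanced_edges d n"
    unfolding e_def f_def by (rule edge; use sub fst in \<open>auto simp: e_def f_def\<close>)+
  have zero: "x v = 0" if outside: "v \<in> V - (e \<union> f)" for v
  proof -
    obtain i j where v: "v = (i, j)" "i < d" "j \<in> g i" using outside by (auto simp: V_def)
    then have "v \<in> {i} \<times> g i - {P i, Q i}" using outside by (auto simp: e_def f_def)
    then show ?thesis using PQ v(2) by blast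
  qed
  have subV: "e \<union> f \<subseteq> V" using sub by auto
  have finS: "finite (e \<union> f)" using subV finV finite_subset by blast
  have "linear_relation (Suc d) h (e \<union> f) x"
    using x(1) linear_relation_restrict[OF finV subV, of x "Suc d" h] zero by simp
  moreover have "\<exists>v\<in>e \<union> f. x v \<noteq> 0" using x(2) zero by blast
  moreover have "uniform (Suc d) h (e \<union> f)"
    using uni subV B(2) by (blast intro: uniform_subset)
  moreover have "(if v \<in> e then 1 else - 1 :: real) \<noteq> 0 \<and> 0 \<le> x v * (if v \<in> e then 1 else - 1)"
    if "v \<in> e \<union> f" for v
  proof -
    have "\<forall>i<d. 0 \<le> x (P i) \<and> x (Q i) \<le> 0" using PQ by blast
    then show ?thesis using that by (auto simp: e_def f_def)
  qed
  ultimately obtain y where y: "linear_relation (Suc d) h (e \<union> f) y"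
    "\<forall>v\<in>e \<union> f. 0 < y v * (if v \<in> e then 1 else - 1)"
    using perturb_to_prescribed_signs[OF finS, of "Suc d" h x "\<lambda>v. if v \<in> e then 1 else - 1"]
    by blast
  have "crossing p e f"
  proof (rule crossing_of_signed_relation[OF gp(1,2) B(1) cardB gp(3)])
    show "linear_relation (Suc d) (\<lambda>v. homogeneous d (p v)) (e \<union> f) y" using y(1) by (simp add: h_def)
    show "e \<subseteq> B" "f \<subseteq> B" "e \<inter> f = {}" using sub B(2) disj by auto
    show "card e \<le> Suc d" "card f \<le> Suc d" using edges by (auto simp: balanced_edges_def)
    show "e \<noteq> {}" using edges(1) d by (auto simp: balanced_edges_def)
    show "0 < y v" if "v \<in> e" for v using bspec[OF y(2), of v] that by simp
    show "y v < 0" if "v \<in> f" for v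
    proof -
      have "v \<notin> e" using disj that by auto
      then show ?thesis using bspec[OF y(2), of v] that by simp
    qed
  qed
  then show ?thesis using edges subV unfolding V_def by blast
qed

lemma card_le_of_double_count:
  assumes "finite U" "\<And>C. C \<in> K \<Longrightarrow> \<exists>u\<in>U. R u C" "\<And>u. u \<in> U \<Longrightarrow> finite {C \<in> K. R u C}"
    "\<And>u. u \<in> U \<Longrightarrow> card {C \<in> K. R u C} \<le> m"
  shows "card K \<le> card U * m"
proof -
  have "K = (\<Union>u\<in>U. {C \<in> K. R u C})" using assms(2) by blast
  then have "card K \<le> (\<Sum>u\<in>U. card {C \<in> K. R u C})" using card_UN_le[OF assms(1)] by metis
  also have "\<dots> \<le> card U * m" using sum_bounded_above[of U _ m] assms(4) by force
  finally show ?thesis .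
qed

text \<open>
  Double counting of selections and the vertex sets of crossing pairs that they contain. A selection
  that contains such a vertex set is determined by its third vertices in the parts $0$ and $1$.
\<close>
lemma crossing_pairs_lower_bound:
  assumes d: "2 \<le> d" and n: "3 \<le> n"
    and draw: "rectilinear_drawing d (balanced_vertices d n) (balanced_edges d n) p"
  shows "(n choose 2) ^ d \<le> 9 * card (crossing_pairs (balanced_edges d n) p)"
proof -
  define X where "X = crossing_pairs (balanced_edges d n) p"
  \<comment> \<open>The vertex sets of crossing pairs.\<close>
  define U where "U = \<Union> ` X"
  define k :: "nat \<Rightarrow> nat" where "k i = (if i < 2 then 3 else 2)" for i
  define G where "G = (\<Pi>\<^sub>E i\<in>{..<d}. {A. A \<subseteq> {..<n} \<and> card A = k i})"
  define K where "K = Sigma {..<d} ` G"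
  have finB: "finite (balanced_vertices d n)" by (simp add: balanced_vertices_eq)
  have "finite (balanced_edges d n)"
    by (rule finite_subset[of _ "Pow (balanced_vertices d n)"]) (use finB in \<open>auto simp: balanced_edges_def\<close>)
  then have "finite ((\<lambda>(e, f). {e, f}) ` (balanced_edges d n \<times> balanced_edges d n))" by simp
  then have finX: "finite X"
    by (rule rev_finite_subset) (auto simp: X_def crossing_pairs_def)
  have U: "u \<subseteq> balanced_vertices d n \<and> (\<forall>i<d. card (u \<inter> part n i) = 2)" if u: "u \<in> U" for u
  proof -
    obtain e f where ef: "u = e \<union> f" "e \<in> balanced_edges d n" "f \<in> balanced_edges d n" "e \<inter> f = {}"
      using u by (auto simp: U_def X_def crossing_pairs_def crossing_def)
    have "card (u \<inter> part n i) = 2" if "i < d" for i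
    proof -
      have "card (e \<inter> part n i) = 1" "card (f \<inter> part n i) = 1"
        using ef(2,3) that by (auto simp: balanced_edges_def)
      moreover have "card ((e \<inter> part n i) \<union> (f \<inter> part n i)) = card (e \<inter> part n i) + card (f \<inter> part n i)"
        by (rule card_Un_disjoint) (use ef(4) in \<open>auto simp: part_def\<close>)
      moreover have "u \<inter> part n i = (e \<inter> part n i) \<union> (f \<inter> part n i)" using ef(1) by auto
      ultimately show ?thesis by simp
    qed
    then show ?thesis using ef by (auto simp: balanced_edges_def)
  qed
  have slice: "Sigma {..<d} g \<inter> part n i = {i} \<times> g i" "g i \<subseteq> {..<n}" "card (g i) = k i"
    if "g \<in> G" "i < d" for g i
  proof -
    have "g i \<in> {A. A \<subseteq> {..<n} \<and> card A = k i}" using that unfolding G_def by (auto elim: PiE_mem)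
    then show "Sigma {..<d} g \<inter> part n i = {i} \<times> g i" "g i \<subseteq> {..<n}" "card (g i) = k i"
      using that(2) by (auto simp: part_def)
  qed
  have "inj_on (Sigma {..<d}) G"
  proof (rule inj_onI)
    fix g g' assume gg: "g \<in> G" "g' \<in> G" "Sigma {..<d} g = Sigma {..<d} g'"
    have "g i = g' i" if "i < d" for i
      using gg(3) that by (auto simp: set_eq_iff)
    then show "g = g'" using gg(1,2) unfolding G_def by (intro PiE_ext) auto
  qed
  then have "card K = card G" unfolding K_def by (rule card_image)
  also have "\<dots> = (\<Prod>i<d. n choose k i)"
    unfolding G_def by (simp add: card_PiE n_subsets)
  finally have cardK: "card K = (\<Prod>i<d. n choose k i)" .
  have fibre: "{C \<in> K. u \<subseteq> C} \<subseteq>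
      (\<lambda>(v, w). u \<union> {v, w}) ` ((part n 0 - u) \<times> (part n 1 - u))" if u: "u \<in> U" for u
  proof
    fix C assume "C \<in> {C \<in> K. u \<subseteq> C}"
    then obtain g where C: "C = Sigma {..<d} g" "g \<in> G" "u \<subseteq> C" by (auto simp: K_def)
    have cC: "card (C \<inter> part n i) = k i" if "i < d" for i
      using slice[OF C(2) that] by (simp add: C(1) card_cartesian_product_singleton)
    have extra: "\<exists>v\<in>part n i - u. C \<inter> part n i = insert v (u \<inter> part n i)" if "i < 2" for i
    proof -
      have i: "i < d" using that d by simp
      have "card (C \<inter> part n i - u \<inter> part n i) = 1"
        using card_Diff_subset[of "u \<inter> part n i" "C \<inter> part n i"] U[OF u] cC[OF i] i C(3) that
        by (auto simp: k_def part_def)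
      then obtain v where "C \<inter> part n i - u \<inter> part n i = {v}" by (auto simp: card_1_singleton_iff)
      then show ?thesis using C(3) by blast
    qed
    obtain v where v: "v \<in> part n 0 - u" "C \<inter> part n 0 = insert v (u \<inter> part n 0)"
      using extra[of 0] by auto
    obtain w where w: "w \<in> part n 1 - u" "C \<inter> part n 1 = insert w (u \<inter> part n 1)"
      using extra[of 1] by auto
    have rest: "C \<inter> part n i = u \<inter> part n i" if "2 \<le> i" "i < d" for i
    proof (rule sym, rule card_subset_eq)
      show "finite (C \<inter> part n i)" by (simp add: part_def)
      show "u \<inter> part n i \<subseteq> C \<inter> part n i" using C(3) by auto
      show "card (u \<inter> part n i) = card (C \<inter> part n i)"
        using U[OF u] cC[OF that(2)] that by (auto simp: k_def)
    qed
    have "C \<subseteq> u \<union> {v, w}"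
    proof
      fix c assume c: "c \<in> C"
      then obtain i where i: "i < d" "c \<in> part n i"
        using slice(2)[OF C(2)] by (force simp: C(1) part_def)
      then consider "i = 0" | "i = 1" | "2 \<le> i" by linarith
      then show "c \<in> u \<union> {v, w}"
        using v(2) w(2) rest[of i] c i by cases blast+
    qed
    moreover have "u \<union> {v, w} \<subseteq> C" using C(3) v(2) w(2) by blast
    ultimately show "C \<in> (\<lambda>(v, w). u \<union> {v, w}) ` ((part n 0 - u) \<times> (part n 1 - u))"
      using v(1) w(1) by (intro image_eqI[of _ _ "(v, w)"]) auto
  qed
  have free: "card (part n i - u) = n - 2" if "u \<in> U" "i < d" for u i
  proof -
    have "card (part n i - u) = card (part n i) - card (part n i \<inter> u)"
      by (rule card_Diff_subset_Int) (simp add: part_def)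
    then show ?thesis using U[OF that(1)] that(2) by (simp add: part_def Int_commute)
  qed
  have "card K \<le> card U * (n - 2)\<^sup>2"
  proof (rule card_le_of_double_count[where R = "\<lambda>u C. u \<subseteq> C"])
    show "finite U" using finX by (simp add: U_def)
    show "\<exists>u\<in>U. u \<subseteq> C" if CK: "C \<in> K" for C
    proof -
      obtain g where g: "C = Sigma {..<d} g" "g \<in> G" using CK by (auto simp: K_def)
      have "\<exists>e\<in>balanced_edges d n. \<exists>f\<in>balanced_edges d n.
          e \<union> f \<subseteq> Sigma {..<d} g \<and> crossing p e f"
        by (rule crossing_in_selection[OF d n draw])
          (use slice(2,3)[OF g(2)] in \<open>simp_all add: k_def\<close>)
      then obtain e f where ef: "e \<in> balanced_edges d n" "f \<in> balanced_edges d n"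
        "e \<union> f \<subseteq> C" "crossing p e f" unfolding g(1) by blast
      have "e \<noteq> {}" using ef(1) d by (auto simp: balanced_edges_def)
      then have "e \<noteq> f" using ef(4) by (auto simp: crossing_def)
      then have "{e, f} \<in> X" using ef by (auto simp: X_def crossing_pairs_def)
      then have "e \<union> f \<in> U" unfolding U_def by (intro image_eqI[of _ _ "{e, f}"]) auto
      then show ?thesis using ef(3) by blast
    qed
    fix u assume u: "u \<in> U"
    have fin: "finite ((part n 0 - u) \<times> (part n 1 - u))" by (simp add: part_def)
    show "finite {C \<in> K. u \<subseteq> C}" using fibre[OF u] fin by (meson finite_imageI finite_subset)
    have "card {C \<in> K. u \<subseteq> C} \<le> card ((part n 0 - u) \<times> (part n 1 - u))"
      using fibre[OF u] fin by (rule surj_card_le[rotated])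
    then show "card {C \<in> K. u \<subseteq> C} \<le> (n - 2)\<^sup>2"
      using free[OF u, of 0] free[OF u, of 1] d by (simp add: card_cartesian_product power2_eq_square)
  qed
  also have "\<dots> \<le> card X * (n - 2)\<^sup>2"
    unfolding U_def using card_image_le[OF finX, of Union] by simp
  finally have K_le: "card K \<le> card X * (n - 2)\<^sup>2" .
  obtain l where l: "d = Suc (Suc l)" using d by (metis add_2_eq_Suc le_Suc_ex)
  have "card K = (n choose 3)\<^sup>2 * (n choose 2) ^ l"
    unfolding cardK l by (simp add: prod.lessThan_Suc_shift k_def power2_eq_square del: prod.lessThan_Suc)
  then have "9 * card K = (3 * (n choose 3))\<^sup>2 * (n choose 2) ^ l"
    by (simp add: power_mult_distrib)
  also have "3 * (n choose 3) = (n - 2) * (n choose 2)"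
    using binomial_absorption[of 2 n] binomial_absorb_comp[of n 2] by (simp add: numeral_3_eq_3)
  also have "((n - 2) * (n choose 2))\<^sup>2 * (n choose 2) ^ l = (n choose 2) ^ d * (n - 2)\<^sup>2"
    unfolding l by (simp add: power_mult_distrib power2_eq_square algebra_simps)
  finally have "(n choose 2) ^ d * (n - 2)\<^sup>2 \<le> (9 * card X) * (n - 2)\<^sup>2"
    using mult_le_mono2[OF K_le, of 9] by (simp only: mult.assoc)
  moreover have "0 < (n - 2)\<^sup>2" using n by simp
  ultimately show ?thesis unfolding X_def by (meson mult_le_cancel2)
qed

theorem theorem1:
  shows "\<exists>c::real. c > 0 \<and> (\<exists>d0::nat. \<forall>d\<ge>d0. \<forall>n::nat. n \<ge> 3 \<longrightarrow>
    real (rectilinear_crossing_number d (balanced_vertices d n) (balanced_edges d n))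
      \<ge> c * 2 ^ d * (real n / 2) ^ d * ((real n - 1) / 2) ^ d)"
proof (intro exI[of _ "1 / 9"] conjI exI[of _ 2] allI impI)
  fix d n :: nat assume d: "2 \<le> d" and n: "3 \<le> n"
  have "d + 1 \<le> d * 3" using d by simp
  also have "\<dots> \<le> d * n" using n by simp
  finally have "Suc d \<le> card (balanced_vertices d n)" by (simp add: balanced_vertices_eq)
  then have "\<exists>p. rectilinear_drawing d (balanced_vertices d n) (balanced_edges d n) p"
    by (intro rectilinear_drawing_exists) (use d in \<open>auto simp: balanced_vertices_eq balanced_edges_def\<close>)
  then have "\<exists>k p. rectilinear_drawing d (balanced_vertices d n) (balanced_edges d n) p \<and>
      k = card (crossing_pairs (balanced_edges d n) p)"
    by blast
  from LeastI_ex[OF this] obtain p where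
    p: "rectilinear_drawing d (balanced_vertices d n) (balanced_edges d n) p"
    "rectilinear_crossing_number d (balanced_vertices d n) (balanced_edges d n)
      = card (crossing_pairs (balanced_edges d n) p)"
    unfolding rectilinear_crossing_number_def by blast
  have "2 * (real n / 2) * ((real n - 1) / 2) = real (n choose 2)"
    using n by (simp add: choose_two real_of_nat_div of_nat_diff)
  moreover have "1 / 9 * 2 ^ d * (real n / 2) ^ d * ((real n - 1) / 2) ^ d
      = 1 / 9 * (2 * (real n / 2) * ((real n - 1) / 2)) ^ d"
    by (simp only: power_mult_distrib mult.assoc)
  ultimately have "1 / 9 * 2 ^ d * (real n / 2) ^ d * ((real n - 1) / 2) ^ d
      = real (n choose 2) ^ d / 9"
    by simp
  also have "\<dots> = real ((n choose 2) ^ d) / 9" by simp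
  also have "\<dots> \<le> real (card (crossing_pairs (balanced_edges d n) p))"
    using crossing_pairs_lower_bound[OF d n p(1)] by linarith
  finally show "1 / 9 * 2 ^ d * (real n / 2) ^ d * ((real n - 1) / 2) ^ d
      \<le> real (rectilinear_crossing_number d (balanced_vertices d n) (balanced_edges d n))"
    by (simp add: p(2))
qed simp

end
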